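(* Let $k\ge 6$ and $g=2d\ge 6$, and let $G$ be a $(k,g)$-graph of excess $4$ with adjacency matrix $A$ and excess matrix $E$. If $\mu\neq\pm k$ is an eigenvalue of $A$, then $$H_{d-1}(\mu)=-\lambda$$ for some eigenvalue $\lambda$ of $E$.
   Context: Graphs are finite and simple. A $(k,g)$-graph is a $k$-regular graph of girth $g$. For even $g=2d$ the Moore bound is $M(k,g)=2\bigl(1+(k-1)+\dots+(k-1)^{d-1}\bigr)$, and the excess of a $(k,g)$-graph of order $n$ is $n-M(k,g)$. For $k\ge 6$ and $g=2d\ge 6$, a $(k,g)$-graph $G$ of excess $4$ is bipartite of diameter $d+1$ (known theorem of Biggs and Ito). The excess matrix $E$ of $G$ is the $n\times n$ matrix indexed by the vertices of $G$ with $E_{u,v}=1$ if the distance $d(u,v)$ in $G$ equals $d+1$, and $E_{u,v}=0$ otherwise. The polynomials $H_i(x)$ are defined by $H_0(x)=1$, $H_1(x)=x$, and $H_{i+1}(x)=xH_i(x)-(k-1)H_{i-1}(x)$ for $i\ge 1$. *)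

theory Defs
  imports
    "Graph_Theory.Pair_Digraph"
    "Jordan_Normal_Form.Char_Poly"
    "HOL-Library.Extended_Nat"
    "HOL-Computational_Algebra.Polynomial"
begin

text \<open>
  A finite simple graph is a \<open>pair_graph\<close>: a finite vertex set together with a symmetric,
  irreflexive set of ordered pairs, an undirected edge \<open>{u, v}\<close> being represented by the two
  arcs \<open>(u, v)\<close> and \<open>(v, u)\<close>. The degree of a vertex is therefore its out-degree.
\<close>

text \<open>Both infima range over \<open>enat\<close>, so the distance between vertices in different components
  and the girth of an acyclic graph are \<open>\<infinity>\<close>.\<close>

definition graph_dist :: "'a pair_pre_digraph \<Rightarrow> 'a \<Rightarrow> 'a \<Rightarrow> enat" where
  "graph_dist G u v = (INF p \<in> {p. pre_digraph.awalk (with_proj G) u p v}. enat (length p))"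

text \<open>The library's \<open>cycle\<close> also admits the closed walk \<open>u, v, u\<close> along the two arcs of a single
  edge; requiring length at least 3 leaves exactly the cycles of the undirected graph.\<close>

definition girth :: "'a pair_pre_digraph \<Rightarrow> enat" where
  "girth G = (INF p \<in> {p. pre_digraph.cycle (with_proj G) p \<and> 3 \<le> length p}. enat (length p))"

definition kg_graph :: "nat \<Rightarrow> nat \<Rightarrow> 'a pair_pre_digraph \<Rightarrow> bool" where
  "kg_graph k g G \<longleftrightarrow>
     pair_graph G \<and> (\<forall>v \<in> pverts G. out_degree (with_proj G) v = k) \<and> girth G = enat g"

text \<open>The Moore bound for even girth only.\<close>

definition moore_bound_even :: "nat \<Rightarrow> nat \<Rightarrow> int" where
  "moore_bound_even k g = 2 * (\<Sum>i < g div 2. (int k - 1) ^ i)"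

definition excess :: "nat \<Rightarrow> nat \<Rightarrow> 'a pair_pre_digraph \<Rightarrow> int" where
  "excess k g G = int (card (pverts G)) - moore_bound_even k g"

text \<open>Matrices indexed by the vertices are taken with respect to an enumeration \<open>vs\<close> of the
  vertex set, i.e. a list with \<open>distinct vs\<close> and \<open>set vs = pverts G\<close>.\<close>

definition adjacency_matrix :: "'a pair_pre_digraph \<Rightarrow> 'a list \<Rightarrow> real mat" where
  "adjacency_matrix G vs =
     mat (length vs) (length vs) (\<lambda>(i, j). if (vs ! i, vs ! j) \<in> parcs G then 1 else 0)"

text \<open>Here \<open>d\<close> is half the girth.\<close>

definition excess_matrix :: "nat \<Rightarrow> 'a pair_pre_digraph \<Rightarrow> 'a list \<Rightarrow> real mat" where
  "excess_matrix d G vs =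
     mat (length vs) (length vs)
       (\<lambda>(i, j). if graph_dist G (vs ! i) (vs ! j) = enat (d + 1) then 1 else 0)"

fun H_poly :: "nat \<Rightarrow> nat \<Rightarrow> real poly" where
  "H_poly k 0 = 1"
| "H_poly k (Suc 0) = [:0, 1:]"
| "H_poly k (Suc (Suc i)) = [:0, 1:] * H_poly k (Suc i) - Polynomial.smult (real k - 1) (H_poly k i)"

end

theory Submission
  imports Defs
begin

text \<open>
  For an edge \<open>{u, v}\<close>, the vertices at distance less than \<open>d\<close> from \<open>u\<close> or \<open>v\<close> form two disjoint
  trees filling the Moore bound, so exactly \<open>e\<close> vertices, the set \<open>X\<close>, lie further away. If some
  \<open>x\<close> in \<open>X\<close> had \<open>a \<ge> 1\<close> neighbours among the leaves of one tree, \<open>b \<ge> 1\<close> among those of the other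
  and \<open>c\<close> in \<open>X\<close>, then each of the \<open>b\<close> leaves would have at least \<open>a\<close> neighbours in \<open>X\<close>, and since
  there are no triangles and no 4-cycles, \<open>e \<ge> 1 + c + b * (a - 1)\<close>. Together with the same bound for
  \<open>a\<close> and \<open>b\<close> interchanged this contradicts \<open>a + b + c = k \<ge> e + 2\<close>. Hence no vertex is equidistant
  from \<open>u\<close> and \<open>v\<close>, and the graph is bipartite of diameter at most \<open>d + 1\<close>.

  For \<open>i < d\<close> the matrix \<open>H_i(A)\<close> is then the indicator of the pairs whose distance is at most \<open>i\<close>
  and of the same parity as \<open>i\<close>, so \<open>H_{d-1}(A) + E\<close> is the indicator of the pairs whose distance
  has the parity of \<open>d - 1\<close>. The latter annihilates every eigenvector of \<open>A\<close> for an eigenvalue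
  other than \<open>k\<close> and \<open>-k\<close>, since such a vector sums to 0 on both colour classes.
\<close>

section \<open>Truncated distances and girth\<close>

locale girth_graph =
  fixes V :: "'a set" and E :: "'a rel" and d :: nat
  assumes finite_V: "finite V"
    and E_subset: "E \<subseteq> V \<times> V"
    and sym_E: "sym E"
    and irrefl_E: "irrefl E"
    and cycle_length: "\<lbrakk>distinct p; successively (\<lambda>x y. (x, y) \<in> E) p; (last p, hd p) \<in> E;
      3 \<le> length p\<rbrakk> \<Longrightarrow> 2 * d \<le> length p"
begin

abbreviation nbrs :: "'a \<Rightarrow> 'a set" where
  "nbrs x \<equiv> E `` {x}"

text \<open>Capping the distance at \<open>d + 2\<close> keeps it a natural number on disconnected graphs and
  does not spoil the Lipschitz property along edges.\<close>

definition tdist :: "'a \<Rightarrow> 'a \<Rightarrow> nat" where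
  "tdist u x = (LEAST m. m = d + 2 \<or> (u, x) \<in> E ^^ m)"

lemma E_sym: "(x, y) \<in> E \<Longrightarrow> (y, x) \<in> E"
  using sym_E by (rule symD)

lemma E_irrefl: "(x, x) \<notin> E"
  using irrefl_E by (simp add: irrefl_def)

lemma E_V: "(x, y) \<in> E \<Longrightarrow> x \<in> V" "(x, y) \<in> E \<Longrightarrow> y \<in> V"
  using E_subset by auto

lemma finite_nbrs: "finite (nbrs x)"
  by (rule finite_subset[OF _ finite_V]) (use E_subset in auto)

lemma tdist_le_cap: "tdist u x \<le> d + 2"
  unfolding tdist_def by (rule Least_le) simp

lemma tdist_le_walk: "(u, x) \<in> E ^^ m \<Longrightarrow> tdist u x \<le> m"
  unfolding tdist_def by (rule Least_le) simp

lemma tdist_walk: "tdist u x < d + 2 \<Longrightarrow> (u, x) \<in> E ^^ tdist u x"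
  using LeastI[of "\<lambda>m. m = d + 2 \<or> (u, x) \<in> E ^^ m" "d + 2"] by (simp add: tdist_def)

lemma relpow_E_sym: "(x, y) \<in> E ^^ m \<Longrightarrow> (y, x) \<in> E ^^ m"
proof (induction m arbitrary: y)
  case (Suc m)
  then obtain z where "(x, z) \<in> E ^^ m" "(z, y) \<in> E" by auto
  with Suc.IH E_sym show ?case by (blast intro: relpow_Suc_I2)
qed auto

lemma tdist_sym: "tdist u x = tdist x u"
  unfolding tdist_def using relpow_E_sym by metis

lemma tdist_self [simp]: "tdist u u = 0"
  using tdist_le_walk[of u u 0] by simp

lemma tdist_eq_0_iff [simp]: "tdist u x = 0 \<longleftrightarrow> u = x"
  using tdist_walk[of u x] by auto

lemma tdist_step:
  assumes "(x, y) \<in> E"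
  shows "tdist u y \<le> Suc (tdist u x)"
proof (cases "tdist u x < d + 2")
  case True
  then have "(u, y) \<in> E ^^ Suc (tdist u x)"
    using assms tdist_walk by (blast intro: relpow_Suc_I)
  then show ?thesis by (rule tdist_le_walk)
next
  case False
  then show ?thesis using tdist_le_cap[of u y] by simp
qed

lemma tdist_step_left: "(x, y) \<in> E \<Longrightarrow> tdist y u \<le> Suc (tdist x u)"
  using tdist_step[of x y u] by (simp add: tdist_sym)

text \<open>The bound \<open>m \<le> d\<close> keeps \<open>Suc m\<close> below the cap, so
  \<open>tdist\<close> is the length of a genuine walk, whose last but one vertex is the
  parent.\<close>

lemma tdist_parent:
  assumes "tdist u x = Suc m" "m \<le> d"
  obtains y where "(y, x) \<in> E" "tdist u y = m"
proof -
  have "(u, x) \<in> E ^^ Suc m" using assms tdist_walk[of u x] by simp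
  then obtain y where y: "(u, y) \<in> E ^^ m" "(y, x) \<in> E" by auto
  then have "tdist u y = m"
    using tdist_le_walk[OF y(1)] tdist_step[OF y(2), of u] assms by simp
  with y that show ?thesis by blast
qed

lemma tdist_eq_1_iff: "tdist u x = 1 \<longleftrightarrow> (u, x) \<in> E"
proof
  assume "tdist u x = 1"
  then show "(u, x) \<in> E" using tdist_walk[of u x] by simp
next
  assume ux: "(u, x) \<in> E"
  then have "tdist u x \<noteq> 0" using E_irrefl by auto
  moreover have "tdist u x \<le> 1" using tdist_step[OF ux, of u] by simp
  ultimately show "tdist u x = 1" by linarith
qed

text \<open>Extend a path whose ends lie on the same level towards \<open>r\<close> until both ends have a common
  parent; this closes a cycle.\<close>

lemma level_path_length:
  assumes "successively (\<lambda>x y. (x, y) \<in> E) p" "distinct p" "2 \<le> length p"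
    and "tdist r (hd p) = m" "tdist r (last p) = m" "\<forall>z\<in>set p. m \<le> tdist r z" "m \<le> d + 1"
  shows "2 * d < length p + 2 * m"
  using assms
proof (induction m arbitrary: p)
  case 0
  then have "hd p = last p" by simp
  then show ?case using 0 by (cases p) (auto split: if_splits)
next
  case (Suc m)
  note prems = Suc.prems
  have ne: "p \<noteq> []" using prems by auto
  obtain a where a: "(a, hd p) \<in> E" "tdist r a = m" using prems by (auto elim: tdist_parent)
  obtain b where b: "(b, last p) \<in> E" "tdist r b = m" using prems by (auto elim: tdist_parent)
  have nin: "a \<notin> set p" "b \<notin> set p" using a b prems by fastforce+
  have suc_a: "successively (\<lambda>x y. (x, y) \<in> E) (a # p)"
    using a prems ne by (simp add: successively_Cons)
  show ?case
  proof (cases "a = b")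
    case True
    have "2 * d \<le> length (a # p)"
      by (rule cycle_length) (use prems nin suc_a b True ne E_sym in auto)
    then show ?thesis by simp
  next
    case False
    have "2 * d < length (a # p @ [b]) + 2 * m"
    proof (rule Suc.IH)
      show "successively (\<lambda>x y. (x, y) \<in> E) (a # p @ [b])"
        using suc_a b E_sym ne by (auto simp: successively_append_iff successively_Cons)
      show "\<forall>z\<in>set (a # p @ [b]). m \<le> tdist r z"
        using a b prems by auto
    qed (use False prems nin a b in auto)
    then show ?thesis by simp
  qed
qed

text \<open>Two parents would give the path \<open>[x, y, x']\<close> with both ends on level
  \<open>m\<close>, hence \<open>2 * d < 2 * m + 3\<close>. At \<open>Suc m = d\<close> this
  inequality is no contradiction.\<close>

lemma unique_parent:
  assumes "(x, y) \<in> E" "(x', y) \<in> E" "tdist r x = m" "tdist r x' = m" "tdist r y = Suc m" "Suc m < d"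
  shows "x = x'"
proof (rule ccontr)
  assume "x \<noteq> x'"
  then have "2 * d < length [x, y, x'] + 2 * m"
    using assms E_sym E_irrefl by (intro level_path_length) auto
  then show False using assms by simp
qed

text \<open>The edge, as a path of two vertices, would close to an odd cycle that is too
  short.\<close>

lemma no_level_edge:
  assumes "(x, y) \<in> E" "tdist r x < d"
  shows "tdist r x \<noteq> tdist r y"
proof
  assume "tdist r x = tdist r y"
  then have "2 * d < length [x, y] + 2 * tdist r x"
    using assms E_irrefl by (intro level_path_length) auto
  then show False using assms by simp
qed

lemma nbr_levels:
  assumes "(x, y) \<in> E" "tdist r x < d"
  shows "tdist r y = Suc (tdist r x) \<or> tdist r x = Suc (tdist r y)"
  using no_level_edge[OF assms] tdist_step[OF assms(1), of r] tdist_step[OF E_sym[OF assms(1)], of r]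
  by linarith

lemma parent_set:
  assumes "tdist r x = Suc m" "Suc m < d"
  obtains p where "p \<in> nbrs x" "{y \<in> nbrs x. tdist r y = m} = {p}"
    "{y \<in> nbrs x. tdist r y = Suc (Suc m)} = nbrs x - {p}"
proof -
  obtain p where p: "(p, x) \<in> E" "tdist r p = m" using assms by (auto elim: tdist_parent)
  have *: "y = p" if "(x, y) \<in> E" "tdist r y = m" for y
    using unique_parent[of y x p r m] p that assms E_sym by blast
  have "{y \<in> nbrs x. tdist r y = Suc (Suc m)} = nbrs x - {p}"
  proof -
    have "tdist r y = Suc (Suc m) \<longleftrightarrow> y \<noteq> p" if "(x, y) \<in> E" for y
      using nbr_levels[OF that, of r] *[OF that] p(2) assms by auto
    then show ?thesis by auto
  qed
  moreover have "{y \<in> nbrs x. tdist r y = m} = {p}" using p * E_sym by auto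
  moreover have "p \<in> nbrs x" using p E_sym by auto
  ultimately show ?thesis using that by blast
qed

end

section \<open>Regular graphs of small excess\<close>

text \<open>The excess is a parameter; the theorem is the case \<open>e = 4\<close>, for which
  \<open>small_excess\<close> reads \<open>6 \<le> k\<close>.\<close>

locale small_excess_graph = girth_graph +
  fixes k e :: nat
  assumes regular: "x \<in> V \<Longrightarrow> card (nbrs x) = k"
    and d_ge_3: "3 \<le> d"
    and small_excess: "e + 2 \<le> k"
    and card_V: "card V = 2 * (\<Sum>i<d. (k - 1) ^ i) + e"
begin

text \<open>For an edge from \<open>u\<close> to \<open>v\<close>, level \<open>m\<close> of the
  tree rooted at \<open>v\<close> that grows away from \<open>u\<close>; swapping \<open>u\<close>
  and \<open>v\<close> gives the other tree.\<close>

definition edge_level :: "'a \<Rightarrow> 'a \<Rightarrow> nat \<Rightarrow> 'a set" where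
  "edge_level u v m = {z \<in> V. tdist v z = m \<and> tdist u z = Suc m}"

definition excess_set :: "'a \<Rightarrow> 'a \<Rightarrow> 'a set" where
  "excess_set u v = {z \<in> V. d \<le> tdist u z \<and> d \<le> tdist v z}"

lemma finite_edge_level: "finite (edge_level u v m)"
  unfolding edge_level_def using finite_V by simp

lemma finite_excess_set: "finite (excess_set u v)"
  unfolding excess_set_def using finite_V by simp

lemma excess_set_sym: "excess_set u v = excess_set v u"
  by (auto simp: excess_set_def)

text \<open>Each level is the disjoint union of the children of the previous one. Children are
  measured by the distance from \<open>u\<close>, so that the root \<open>v\<close> also has a
  parent, namely \<open>u\<close>, and \<open>k - 1\<close> children. Disjointness comes from unique
  parents with respect to \<open>v\<close>.\<close>

lemma card_edge_level:
  assumes "(u, v) \<in> E" "m < d"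
  shows "card (edge_level u v m) = (k - 1) ^ m"
  using assms(2)
proof (induction m)
  case 0
  have "edge_level u v 0 = {v}"
    using assms E_V tdist_eq_1_iff[of u v] by (auto simp: edge_level_def)
  then show ?case by simp
next
  case (Suc m)
  let ?ch = "\<lambda>z. {y \<in> nbrs z. tdist u y = Suc (Suc m)}"
  have child: "tdist v y = Suc m" if "z \<in> edge_level u v m" "y \<in> ?ch z" for z y
    using that tdist_step[of z y v] tdist_step_left[OF E_sym[OF assms(1)], of y]
    by (simp add: edge_level_def)
  have "edge_level u v (Suc m) = (\<Union>z\<in>edge_level u v m. ?ch z)" (is "?L = ?R")
  proof
    show "?R \<subseteq> ?L"
    proof
      fix y assume "y \<in> ?R"
      then obtain z where z: "z \<in> edge_level u v m" "y \<in> ?ch z" by blast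
      then show "y \<in> ?L" using child[OF z] E_V by (auto simp: edge_level_def)
    qed
    show "?L \<subseteq> ?R"
    proof
      fix y assume y: "y \<in> ?L"
      then obtain z where z: "(z, y) \<in> E" "tdist v z = m"
        using Suc.prems by (auto simp: edge_level_def elim: tdist_parent)
      have "tdist u z = Suc m"
        using y z tdist_step[OF z(1), of u] tdist_step_left[OF E_sym[OF assms(1)], of z]
        by (simp add: edge_level_def)
      then show "y \<in> ?R" using y z E_V by (auto simp: edge_level_def)
    qed
  qed
  also have "card \<dots> = (\<Sum>z\<in>edge_level u v m. card (?ch z))"
  proof (rule card_UN_disjoint)
    show "\<forall>z\<in>edge_level u v m. \<forall>z'\<in>edge_level u v m. z \<noteq> z' \<longrightarrow> ?ch z \<inter> ?ch z' = {}"
    proof (intro ballI impI)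
      fix z z' assume z: "z \<in> edge_level u v m" "z' \<in> edge_level u v m" "z \<noteq> z'"
      have False if "y \<in> ?ch z" "y \<in> ?ch z'" for y
        using unique_parent[of z y z' v m] z that child[of z y] Suc.prems
        by (simp add: edge_level_def)
      then show "?ch z \<inter> ?ch z' = {}" by blast
    qed
    show "\<forall>z\<in>edge_level u v m. finite (?ch z)"
      using finite_nbrs by (auto intro: finite_subset[of _ "nbrs _"])
  qed (rule finite_edge_level)
  also have "\<dots> = (\<Sum>z\<in>edge_level u v m. k - 1)"
  proof (rule sum.cong)
    fix z assume "z \<in> edge_level u v m"
    then have z: "tdist u z = Suc m" "z \<in> V" by (auto simp: edge_level_def)
    obtain p where "p \<in> nbrs z" "?ch z = nbrs z - {p}"
      using parent_set[OF z(1) Suc.prems] by metis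
    then show "card (?ch z) = k - 1"
      using regular[OF z(2)] finite_nbrs by simp
  qed simp
  also have "\<dots> = (k - 1) ^ Suc m" using Suc by simp
  finally show ?case .
qed

lemma edge_dists:
  assumes "(u, v) \<in> E"
  shows "tdist v z \<le> Suc (tdist u z)" "tdist u z \<le> Suc (tdist v z)"
  using tdist_step_left[OF assms] tdist_step_left[OF E_sym[OF assms]] by auto

lemma edge_dists_neq:
  assumes "(u, v) \<in> E" "tdist u z < d"
  shows "tdist u z \<noteq> tdist v z"
  using no_level_edge[OF assms(1), of z] assms(2) by (simp add: tdist_sym)

text \<open>The two trees are disjoint, since a vertex of either is strictly nearer to its own root,
  and their sizes add up to the Moore bound.\<close>

lemma card_excess_set:
  assumes "(u, v) \<in> E"
  shows "card (excess_set u v) = e"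
proof -
  let ?A = "\<Union>m<d. edge_level u v m" and ?B = "\<Union>m<d. edge_level v u m"
  have card_UN: "card (\<Union>m<d. edge_level x y m) = (\<Sum>m<d. (k - 1) ^ m)"
    if "(x, y) \<in> E" for x y
  proof -
    have "card (\<Union>m<d. edge_level x y m) = (\<Sum>m<d. card (edge_level x y m))"
      by (rule card_UN_disjoint) (auto simp: finite_edge_level, auto simp: edge_level_def)
    then show ?thesis using card_edge_level[OF that] by simp
  qed
  have "V = (?A \<union> ?B) \<union> excess_set u v"
  proof
    show "V \<subseteq> (?A \<union> ?B) \<union> excess_set u v"
    proof
      fix z assume z: "z \<in> V"
      consider "z \<in> excess_set u v" | "tdist u z < d" | "tdist v z < d"
        using z by (force simp: excess_set_def)
      then have "z \<in> excess_set u v \<or> (tdist v z < d \<and> tdist u z = Suc (tdist v z))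
          \<or> (tdist u z < d \<and> tdist v z = Suc (tdist u z))"
        using edge_dists_neq[OF assms, of z] edge_dists_neq[OF E_sym[OF assms], of z]
          edge_dists[OF assms, of z] by cases linarith+
      then show "z \<in> (?A \<union> ?B) \<union> excess_set u v"
        using z by (auto simp: edge_level_def)
    qed
  qed (auto simp: edge_level_def excess_set_def)
  moreover have "card ((?A \<union> ?B) \<union> excess_set u v) = card ?A + card ?B + card (excess_set u v)"
  proof -
    have "finite ?A" "finite ?B" using finite_edge_level by auto
    moreover have A: "tdist v z < tdist u z \<and> tdist v z < d" if "z \<in> ?A" for z
      using that by (auto simp: edge_level_def)
    moreover have B: "tdist u z < tdist v z \<and> tdist u z < d" if "z \<in> ?B" for z
      using that by (auto simp: edge_level_def)
    have "?A \<inter> ?B = {}" using A B by (meson disjoint_iff less_asym)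
    moreover have "(?A \<union> ?B) \<inter> excess_set u v = {}"
      unfolding excess_set_def using A B by (blast dest: leD)
    ultimately show ?thesis using finite_excess_set by (simp add: card_Un_disjoint)
  qed
  ultimately show ?thesis
    using card_UN[OF assms] card_UN[OF E_sym[OF assms]] card_V by simp
qed

section \<open>Neighbours of the vertices far from an edge\<close>

lemma nbrs_excess:
  assumes uv: "(u, v) \<in> E" and x: "x \<in> excess_set u v"
  shows "nbrs x = (nbrs x \<inter> edge_level v u (d - 1)) \<union> (nbrs x \<inter> edge_level u v (d - 1))
    \<union> (nbrs x \<inter> excess_set u v)"
proof -
  \<comment> \<open>Both distances of \<open>z\<close> are at least \<open>d - 1\<close>. If one
    equals \<open>d - 1\<close>, the other is \<open>d\<close>, as no vertex closer than
    \<open>d\<close> is equidistant from \<open>u\<close> and \<open>v\<close>.\<close>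
  have "z \<in> edge_level v u (d - 1) \<union> edge_level u v (d - 1) \<union> excess_set u v"
    if xz: "(x, z) \<in> E" for z
    using x E_V(2)[OF xz] tdist_step[OF E_sym[OF xz], of u] tdist_step[OF E_sym[OF xz], of v]
      edge_dists_neq[OF uv, of z] edge_dists_neq[OF E_sym[OF uv], of z] edge_dists[OF uv, of z] d_ge_3
    by (auto simp: edge_level_def excess_set_def)
  then show ?thesis by blast
qed

text \<open>A vertex of \<open>edge_level v u (d - 1)\<close> descends from a unique neighbour of \<open>u\<close>, its branch.
  The neighbours of \<open>x\<close> and of \<open>y\<close> on that level all lie in different branches, for otherwise
  there would be a cycle of length less than \<open>2 * d\<close>, and there are only \<open>k - 1\<close> branches.\<close>

lemma leaf_excess_nbrs:
  assumes uv: "(u, v) \<in> E" and x: "x \<in> excess_set u v" and y: "y \<in> edge_level u v (d - 1)"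
    and xy: "(x, y) \<in> E"
  shows "card (nbrs x \<inter> edge_level v u (d - 1)) \<le> card (nbrs y \<inter> excess_set u v)"
proof -
  let ?P = "nbrs x \<inter> edge_level v u (d - 1)" and ?Q = "nbrs y \<inter> edge_level v u (d - 1)"
  obtain c where c: "d = Suc (Suc c)" using d_ge_3 by (metis add_2_eq_Suc le_Suc_ex numeral_3_eq_3 plus_nat.simps(2))
  then have c': "d - 1 = Suc c" by simp
  have far: "d \<le> tdist u w" if "w \<in> {x, y}" for w
    using that x y by (auto simp: excess_set_def edge_level_def)
  have "\<exists>i. (u, i) \<in> E \<and> tdist i z = c" if "z \<in> ?P \<union> ?Q" for z
  proof -
    have "tdist z u = Suc c" using that c' by (auto simp: edge_level_def tdist_sym[of z u])
    then obtain i where "(i, u) \<in> E" "tdist z i = c"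
      using tdist_parent[of z u c] c by auto
    then show ?thesis using E_sym tdist_sym by metis
  qed
  then obtain br where br: "\<And>z. z \<in> ?P \<union> ?Q \<Longrightarrow> (u, br z) \<in> E \<and> tdist (br z) z = c"
    by metis
  have br_far: "tdist (br z) w = Suc c" if "z \<in> ?P \<union> ?Q" "w \<in> {x, y}" "(w, z) \<in> E" for z w
    using br[OF that(1)] far[OF that(2)] tdist_step[OF E_sym[OF that(3)], of "br z"]
      tdist_step_left[of "br z" u w] E_sym c by force
  \<comment> \<open>Let two leaves share a branch. If they hang on different ends of the edge from
    \<open>x\<close> to \<open>y\<close>, this edge joins vertices of one level around the branch;
    if they hang on the same end, that end has two parents.\<close>
  have inj: "inj_on br (?P \<union> ?Q)"
  proof (rule inj_onI)
    fix z z' assume z: "z \<in> ?P \<union> ?Q" and z': "z' \<in> ?P \<union> ?Q" and eq: "br z = br z'"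
    obtain w where w: "w \<in> {x, y}" "(w, z) \<in> E" using z by blast
    obtain w' where w': "w' \<in> {x, y}" "(w', z') \<in> E" using z' by blast
    have dist: "tdist (br z) w = Suc c" "tdist (br z) w' = Suc c"
      using br_far[OF z w] br_far[OF z' w'] eq by auto
    have "w = w'"
      using no_level_edge[OF xy, of "br z"] w w' dist c by auto
    then show "z = z'"
      using unique_parent[of z w z' "br z" c] w w' dist br[OF z] br[OF z'] eq c E_sym by simp
  qed
  have "br ` (?P \<union> ?Q) \<subseteq> nbrs u - {v}"
  proof
    fix i assume "i \<in> br ` (?P \<union> ?Q)"
    then obtain z where z: "z \<in> ?P \<union> ?Q" "i = br z" by blast
    then have "tdist v z = Suc (Suc c)" using c' by (auto simp: edge_level_def)
    then show "i \<in> nbrs u - {v}" using br[OF z(1)] z by auto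
  qed
  then have "card (?P \<union> ?Q) \<le> card (nbrs u - {v})"
    using inj finite_nbrs by (metis card_image card_mono finite_Diff)
  also have "\<dots> = k - 1" using uv regular E_V finite_nbrs by simp
  also have "card (?P \<union> ?Q) = card ?P + card ?Q"
  proof (rule card_Un_disjoint)
    have False if "z \<in> ?P" "z \<in> ?Q" for z
      using that no_level_edge[OF xy, of z] d_ge_3 tdist_eq_1_iff[of z x] tdist_eq_1_iff[of z y]
      by (auto dest: E_sym)
    then show "?P \<inter> ?Q = {}" by blast
  qed (use finite_nbrs in auto)
  finally have PQ: "card ?P + card ?Q \<le> k - 1" .
  \<comment> \<open>Besides one parent towards \<open>v\<close>, all neighbours of \<open>y\<close>
    lie in \<open>?Q\<close> or in the excess set; comparison with \<open>PQ\<close> then cancels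
    \<open>card ?Q\<close>.\<close>
  have yv: "tdist v y = Suc c" "y \<in> V" "d \<le> tdist u y"
    using y c' by (auto simp: edge_level_def)
  obtain p where p: "{z \<in> nbrs y. tdist v z = Suc (Suc c)} = nbrs y - {p}"
    using parent_set[OF yv(1)] c by (metis lessI)
  have "nbrs y \<subseteq> {p} \<union> ?Q \<union> (nbrs y \<inter> excess_set u v)"
  proof
    fix z assume z: "z \<in> nbrs y"
    have "z \<in> ?Q \<union> (nbrs y \<inter> excess_set u v)" if "z \<noteq> p"
    proof -
      have "tdist v z = d" using p z that c by blast
      moreover have "d \<le> Suc (tdist u z)" using z yv(3) tdist_step[of z y u] E_sym by force
      ultimately show ?thesis
        using z E_V(2)[of y z] d_ge_3 by (auto simp: edge_level_def excess_set_def)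
    qed
    then show "z \<in> {p} \<union> ?Q \<union> (nbrs y \<inter> excess_set u v)" by blast
  qed
  then have "k \<le> card ({p} \<union> ?Q \<union> (nbrs y \<inter> excess_set u v))"
    using regular[OF yv(2)] finite_nbrs by (metis card_mono finite.emptyI finite.insertI finite_Int finite_UnI)
  also have "\<dots> \<le> card ({p} \<union> ?Q) + card (nbrs y \<inter> excess_set u v)" by (rule card_Un_le)
  also have "\<dots> \<le> 1 + card ?Q + card (nbrs y \<inter> excess_set u v)"
    using card_Un_le[of "{p}" ?Q] by simp
  finally show ?thesis using PQ small_excess by linarith
qed

text \<open>Three disjoint kinds of vertices of the excess set are counted: \<open>x\<close>, its
  neighbours there, and those reached from \<open>x\<close> through a leaf of the tree at
  \<open>v\<close>.\<close>

lemma excess_count: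
  assumes uv: "(u, v) \<in> E" and x: "x \<in> excess_set u v"
  shows "1 + card (nbrs x \<inter> excess_set u v) + card (nbrs x \<inter> edge_level u v (d - 1))
    * (card (nbrs x \<inter> edge_level v u (d - 1)) - 1) \<le> e"
proof -
  let ?X = "excess_set u v"
  let ?A = "nbrs x \<inter> edge_level v u (d - 1)" and ?B = "nbrs x \<inter> edge_level u v (d - 1)"
    and ?C = "nbrs x \<inter> ?X"
  let ?D = "\<lambda>y. nbrs y \<inter> ?X - {x}"
  let ?U = "\<Union>y\<in>?B. ?D y"
  have fin: "finite ?A" "finite ?B" "finite ?C" "\<And>y. finite (?D y)"
    using finite_nbrs by auto
  have "card ?B * (card ?A - 1) = (\<Sum>y\<in>?B. card ?A - 1)" by simp
  also have "\<dots> \<le> (\<Sum>y\<in>?B. card (?D y))"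
  proof (rule sum_mono)
    fix y assume y: "y \<in> ?B"
    then have "card ?A \<le> card (nbrs y \<inter> ?X)"
      using leaf_excess_nbrs[OF uv x] by blast
    then show "card ?A - 1 \<le> card (?D y)"
      using finite_nbrs[of y] y x E_sym by simp
  qed
  also have "\<dots> = card ?U"
  proof (rule card_UN_disjoint[symmetric])
    show "\<forall>y\<in>?B. \<forall>y'\<in>?B. y \<noteq> y' \<longrightarrow> ?D y \<inter> ?D y' = {}"
    proof (intro ballI impI)
      fix y y' assume y: "y \<in> ?B" "y' \<in> ?B" "y \<noteq> y'"
      \<comment> \<open>A second common neighbour \<open>z\<close> of \<open>y\<close> and
        \<open>y'\<close> would lie on level 2 around \<open>x\<close> with two parents;
        \<open>d \<ge> 3\<close> puts this level below \<open>d\<close>.\<close>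
      have False if z: "z \<in> ?D y" "z \<in> ?D y'" for z
      proof -
        have 1: "tdist x y = 1" "tdist x y' = 1" using y by (auto simp: tdist_eq_1_iff[unfolded One_nat_def])
        have "tdist x z = 2"
          using nbr_levels[of y z x] z 1 d_ge_3 by auto
        then show False
          using unique_parent[of y z y' x 1] y z 1 d_ge_3 by auto
      qed
      then show "?D y \<inter> ?D y' = {}" by blast
    qed
  qed (use fin in auto)
  finally have "card ?B * (card ?A - 1) \<le> card ?U" .
  moreover have "card ({x} \<union> ?C \<union> ?U) = 1 + card ?C + card ?U"
  proof -
    have "?C \<inter> ?U = {}"
    proof -
      have False if "z \<in> ?C" "y \<in> ?B" "z \<in> ?D y" for y z
        using no_level_edge[of y z x] that tdist_eq_1_iff[of x y] tdist_eq_1_iff[of x z] d_ge_3 by auto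
      then show ?thesis by blast
    qed
    moreover have "x \<notin> ?C \<union> ?U" using E_irrefl by auto
    moreover have "finite ?U" using fin by blast
    ultimately have "card (?C \<union> ?U) = card ?C + card ?U" "card (insert x (?C \<union> ?U)) = Suc (card (?C \<union> ?U))"
      using fin by (auto intro: card_Un_disjoint card_insert_disjoint)
    then show ?thesis by simp
  qed
  moreover have "card ({x} \<union> ?C \<union> ?U) \<le> card ?X"
    by (rule card_mono) (use finite_excess_set x in auto)
  ultimately show ?thesis using card_excess_set[OF uv] by linarith
qed

lemma excess_nbrs_sides:
  assumes uv: "(u, v) \<in> E" and x: "x \<in> excess_set u v"
  shows "nbrs x \<inter> edge_level u v (d - 1) = {} \<longleftrightarrow> nbrs x \<inter> edge_level v u (d - 1) \<noteq> {}"
proof -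
  let ?X = "excess_set u v"
  let ?A = "nbrs x \<inter> edge_level v u (d - 1)" and ?B = "nbrs x \<inter> edge_level u v (d - 1)"
    and ?C = "nbrs x \<inter> ?X"
  have "k \<le> card (?A \<union> ?B \<union> ?C)"
    using nbrs_excess[OF uv x] regular[of x] x by (simp add: excess_set_def)
  also have "\<dots> \<le> card ?A + card ?B + card ?C"
    using card_Un_le[of "?A \<union> ?B" ?C] card_Un_le[of ?A ?B] by linarith
  finally have deg: "k \<le> card ?A + card ?B + card ?C" .
  have 1: "1 + card ?C + card ?B * (card ?A - 1) \<le> e"
    using excess_count[OF uv x] .
  have 2: "1 + card ?C + card ?A * (card ?B - 1) \<le> e"
    using excess_count[OF E_sym[OF uv], of x] x excess_set_sym[of u v] by simp
  have "\<not> (card ?A \<ge> 1 \<and> card ?B \<ge> 1)"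
  proof
    assume "card ?A \<ge> 1 \<and> card ?B \<ge> 1"
    then obtain a b where ab: "card ?A = Suc a" "card ?B = Suc b"
      by (metis Suc_le_D One_nat_def)
    have "1 + card ?C + (a + a * b) \<le> e" "1 + card ?C + (b + a * b) \<le> e"
      using 1 2 unfolding ab by (auto simp: algebra_simps)
    \<comment> \<open>If \<open>a\<close> and \<open>b\<close> are positive, \<open>a * b\<close>
      replaces the missing summand; if one is 0, one of the two inequalities suffices. Either way
      \<open>1 + card ?C + a + b \<le> e\<close>, whereas the degree gives
      \<open>k \<le> a + b + card ?C + 2\<close>.\<close>
    moreover have "b \<le> a * b \<or> a = 0" "a \<le> a * b \<or> b = 0" by auto
    ultimately show False using deg small_excess unfolding ab by linarith
  qed
  moreover have "card ?A \<noteq> 0 \<or> card ?B \<noteq> 0"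
    using deg 1 small_excess by linarith
  moreover have "finite ?A" "finite ?B" using finite_nbrs by auto
  ultimately show ?thesis by (metis One_nat_def Suc_leI card_gt_0_iff card.empty)
qed

section \<open>Bipartiteness and diameter\<close>

lemma excess_side_dist:
  assumes uv: "(u, v) \<in> E" and x: "x \<in> excess_set u v"
    and ne: "nbrs x \<inter> edge_level v u (d - 1) \<noteq> {}"
  shows "tdist u x = d \<and> tdist v x = Suc d"
proof -
  obtain y where y: "(x, y) \<in> E" "tdist u y = d - 1" using ne by (auto simp: edge_level_def)
  have "tdist u x = d"
    using tdist_step[OF E_sym[OF y(1)], of u] y x d_ge_3 by (simp add: excess_set_def)
  \<comment> \<open>Were \<open>x\<close> at distance \<open>d\<close> from \<open>v\<close>, its
    parent towards \<open>v\<close> would be a leaf of the tree at \<open>v\<close>, and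
    \<open>x\<close> would have neighbours in both trees.\<close>
  moreover have "tdist v x \<noteq> d"
  proof
    assume "tdist v x = d"
    then obtain z where z: "(z, x) \<in> E" "tdist v z = d - 1"
      using d_ge_3 tdist_parent[of v x "d - 1"] by auto
    have "tdist u z = d"
      using tdist_step[OF z(1), of u] edge_dists[OF uv, of z] edge_dists_neq[OF uv, of z]
        z(2) x d_ge_3 by (cases "tdist u z < d") (auto simp: excess_set_def)
    then have "z \<in> nbrs x \<inter> edge_level u v (d - 1)"
      using z E_sym E_V d_ge_3 by (auto simp: edge_level_def)
    then show False using excess_nbrs_sides[OF uv x] ne by blast
  qed
  ultimately show ?thesis using edge_dists[OF uv, of x] x by (auto simp: excess_set_def)
qed

text \<open>The inequality makes the parity of distances alternate along edges; the bound keeps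
  distances below the cap, so the graph is connected.\<close>

lemma bipartite_diameter:
  assumes uv: "(u, v) \<in> E" and z: "z \<in> V"
  shows "tdist u z \<noteq> tdist v z \<and> tdist u z \<le> d + 1"
proof (cases "z \<in> excess_set u v")
  case True
  then have vu: "z \<in> excess_set v u" by (simp add: excess_set_sym)
  consider "nbrs z \<inter> edge_level v u (d - 1) \<noteq> {}" | "nbrs z \<inter> edge_level u v (d - 1) \<noteq> {}"
    using excess_nbrs_sides[OF uv True] by blast
  then show ?thesis
  proof cases
    case 1
    then show ?thesis using excess_side_dist[OF uv True] by simp
  next
    case 2
    then show ?thesis using excess_side_dist[OF E_sym[OF uv] vu] by simp
  qed
next
  case False
  then have "tdist u z < d \<or> tdist v z < d" using z by (auto simp: excess_set_def)
  moreover from this have "tdist u z \<noteq> tdist v z"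
    using edge_dists_neq[OF uv, of z] edge_dists_neq[OF E_sym[OF uv], of z] by metis
  ultimately show ?thesis using edge_dists[OF uv, of z] by auto
qed

lemma edge_parity:
  assumes "(u, v) \<in> E" "z \<in> V"
  shows "even (tdist u z) \<longleftrightarrow> odd (tdist v z)"
proof -
  have "tdist u z = Suc (tdist v z) \<or> tdist v z = Suc (tdist u z)"
    using bipartite_diameter[OF assms] edge_dists[OF assms(1), of z] by linarith
  then show ?thesis by auto
qed

lemma tdist_le:
  assumes "u \<in> V" "z \<in> V"
  shows "tdist u z \<le> d + 1"
proof -
  have "card (nbrs u) > 0" using regular[OF assms(1)] small_excess by simp
  then obtain v where "(u, v) \<in> E" by (auto simp: card_gt_0_iff)
  then show ?thesis using bipartite_diameter assms by blast
qed

section \<open>Eigenvectors\<close>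

definition parity_ball :: "nat \<Rightarrow> 'a \<Rightarrow> 'a set" where
  "parity_ball i u = {w \<in> V. tdist u w \<le> i \<and> (even (tdist u w) \<longleftrightarrow> even i)}"

text \<open>The recurrence of \<open>H_poly\<close> read entrywise, with parity balls as rows. If
  \<open>w\<close> is within distance \<open>i\<close> of \<open>u\<close>, all
  \<open>k = 1 + (k - 1)\<close> neighbours count; at distance \<open>i + 2\<close> only the unique
  parent does; parity excludes \<open>i + 1\<close>.\<close>

lemma card_nbrs_parity_ball:
  assumes u: "u \<in> V" and w: "w \<in> V" and i: "Suc (Suc i) < d"
  shows "card {x \<in> nbrs u. w \<in> parity_ball (Suc i) x}
    = of_bool (w \<in> parity_ball (Suc (Suc i)) u) + (k - 1) * of_bool (w \<in> parity_ball i u)"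
proof -
  have par: "even (tdist x w) \<longleftrightarrow> odd (tdist u w)" if "x \<in> nbrs u" for x
    using edge_parity[OF _ w, of u x] that by auto
  have near: "tdist x w \<le> Suc (tdist u w)" "tdist u w \<le> Suc (tdist x w)" if "x \<in> nbrs u" for x
    using edge_dists[of u x w] that by auto
  show ?thesis
  proof (cases "even (tdist u w) \<longleftrightarrow> even i")
    case False
    then have empty: "{x \<in> nbrs u. w \<in> parity_ball (Suc i) x} = {}"
      using par by (auto simp: parity_ball_def)
    show ?thesis unfolding empty using False by (simp add: parity_ball_def)
  next
    case True
    have eq: "{x \<in> nbrs u. w \<in> parity_ball (Suc i) x} = {x \<in> nbrs u. tdist x w \<le> Suc i}"
      using par True w by (auto simp: parity_ball_def)
    consider "tdist u w \<le> i" | "tdist u w = Suc (Suc i)" | "tdist u w > Suc (Suc i)"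
      using True by (metis even_Suc le_neq_implies_less not_less_eq_eq linorder_not_le)
    then show ?thesis
    proof cases
      case 1
      then have "{x \<in> nbrs u. tdist x w \<le> Suc i} = nbrs u" using near by force
      then show ?thesis
        using 1 True w eq regular[OF u] small_excess by (simp add: parity_ball_def)
    next
      case 2
      then have wu: "tdist w u = Suc (Suc i)" by (simp add: tdist_sym)
      obtain p where "{y \<in> nbrs u. tdist w y = Suc i} = {p}"
        using parent_set[OF wu i] by metis
      moreover have "{x \<in> nbrs u. tdist x w \<le> Suc i} = {y \<in> nbrs u. tdist w y = Suc i}"
        using near 2 by (force simp: tdist_sym[of w])
      ultimately show ?thesis
        using 2 True w eq by (simp add: parity_ball_def)
    next
      case 3
      then have empty: "{x \<in> nbrs u. tdist x w \<le> Suc i} = {}" using near by force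
      show ?thesis unfolding eq empty using 3 by (simp add: parity_ball_def)
    qed
  qed
qed

context
  fixes f :: "'a \<Rightarrow> real" and \<mu> :: real
  assumes eigen: "\<And>u. u \<in> V \<Longrightarrow> (\<Sum>w\<in>nbrs u. f w) = \<mu> * f u"
begin

lemma H_poly_eigen:
  assumes "i < d" "u \<in> V"
  shows "poly (H_poly k i) \<mu> * f u = (\<Sum>w\<in>parity_ball i u. f w)"
  using assms
proof (induction i arbitrary: u rule: induct_nat_012)
  case 0
  then have "parity_ball 0 u = {u}" by (auto simp: parity_ball_def)
  then show ?case by simp
next
  case 1
  have "w \<in> parity_ball (Suc 0) u \<longleftrightarrow> w \<in> nbrs u" for w
    using tdist_eq_1_iff[of u w] E_V[of u w]
    by (auto simp: parity_ball_def le_Suc_eq)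
  then have "parity_ball (Suc 0) u = nbrs u" by blast
  then show ?case using eigen[OF 1(2)] by simp
next
  case (ge2 i)
  \<comment> \<open>Indicators let every sum range over all of \<open>V\<close>, so that the
    summations over \<open>x\<close> and \<open>w\<close> can be swapped.\<close>
  define b where "b j x w = (of_bool (w \<in> parity_ball j x) :: real)" for j x w
  have sum_b: "(\<Sum>w\<in>parity_ball j x. f w) = (\<Sum>w\<in>V. b j x w * f w)" for j x
  proof -
    have "(\<Sum>w\<in>V. b j x w * f w) = (\<Sum>w\<in>V. if w \<in> parity_ball j x then f w else 0)"
      by (rule sum.cong) (auto simp: b_def)
    also have "\<dots> = (\<Sum>w\<in>V \<inter> parity_ball j x. f w)"
      using finite_V by (simp add: sum.inter_restrict)
    also have "V \<inter> parity_ball j x = parity_ball j x" by (auto simp: parity_ball_def)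
    finally show ?thesis by simp
  qed
  have k: "real (k - Suc 0) = real k - 1" using small_excess by simp
  have count: "(\<Sum>x\<in>nbrs u. b (Suc i) x w) = b (Suc (Suc i)) u w + (real k - 1) * b i u w"
    if "w \<in> V" for w
  proof -
    have "(\<Sum>x\<in>nbrs u. b (Suc i) x w) = real (card {x \<in> nbrs u. w \<in> parity_ball (Suc i) x})"
      unfolding b_def using finite_nbrs by (simp add: of_bool_def sum.If_cases Int_def)
    then show ?thesis
      using card_nbrs_parity_ball[OF ge2.prems(2) that ge2.prems(1)] by (simp add: b_def k)
  qed
  have "\<mu> * (poly (H_poly k (Suc i)) \<mu> * f u) = (\<Sum>x\<in>nbrs u. poly (H_poly k (Suc i)) \<mu> * f x)"
    using eigen[OF ge2.prems(2)] by (simp add: sum_distrib_left[symmetric])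
  also have "\<dots> = (\<Sum>x\<in>nbrs u. \<Sum>w\<in>V. b (Suc i) x w * f w)"
    using ge2.IH(2) ge2.prems E_V by (intro sum.cong) (auto simp: sum_b)
  also have "\<dots> = (\<Sum>w\<in>V. (\<Sum>x\<in>nbrs u. b (Suc i) x w) * f w)"
    by (subst sum.swap) (simp add: sum_distrib_right)
  also have "\<dots> = (\<Sum>w\<in>V. b (Suc (Suc i)) u w * f w) + (real k - 1) * (\<Sum>w\<in>V. b i u w * f w)"
    by (simp add: count distrib_right sum.distrib sum_distrib_left mult.assoc)
  also have "(\<Sum>w\<in>V. b i u w * f w) = poly (H_poly k i) \<mu> * f u"
    using ge2.IH(1)[of u] ge2.prems by (simp add: sum_b)
  finally show ?case by (simp add: sum_b algebra_simps)
qed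

text \<open>Summing the eigenvalue equation over one class counts each vertex of the other class
  \<open>k\<close> times. Doing so twice shows that \<open>(\<mu> - k) * (\<mu> + k)\<close>
  annihilates the class sum.\<close>

lemma parity_class_sum_eq_0:
  assumes r: "r \<in> V" and \<mu>: "\<mu> \<noteq> real k" "\<mu> \<noteq> - real k"
  shows "(\<Sum>w | w \<in> V \<and> (even (tdist r w) \<longleftrightarrow> c). f w) = 0"
proof -
  define P where "P c = {w \<in> V. even (tdist r w) \<longleftrightarrow> c}" for c
  have finite_P: "finite (P c)" for c unfolding P_def using finite_V by simp
  have parity: "even (tdist r u) \<longleftrightarrow> odd (tdist r w)" if "(u, w) \<in> E" for u w
    using edge_parity[OF that r] by (simp add: tdist_sym)
  have swap: "\<mu> * sum f (P c) = real k * sum f (P (\<not> c))" for c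
  proof -
    have "\<mu> * sum f (P c) = (\<Sum>u\<in>P c. \<Sum>w\<in>nbrs u. f w)"
      unfolding sum_distrib_left by (rule sum.cong) (auto simp: eigen P_def)
    also have "\<dots> = (\<Sum>u\<in>P c. \<Sum>w | w \<in> P (\<not> c) \<and> (u, w) \<in> E. f w)"
      using parity E_V by (intro sum.cong) (auto simp: P_def)
    also have "\<dots> = (\<Sum>w\<in>P (\<not> c). \<Sum>u | u \<in> P c \<and> (u, w) \<in> E. f w)"
      by (rule sum.swap_restrict) (rule finite_P)+
    also have "\<dots> = (\<Sum>w\<in>P (\<not> c). real k * f w)"
    proof (rule sum.cong)
      fix w assume w: "w \<in> P (\<not> c)"
      have "{u. u \<in> P c \<and> (u, w) \<in> E} = nbrs w"
        using w parity E_V E_sym by (auto simp: P_def)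
      then show "(\<Sum>u | u \<in> P c \<and> (u, w) \<in> E. f w) = real k * f w"
        using regular[of w] w by (simp add: P_def)
    qed simp
    finally show ?thesis by (simp add: sum_distrib_left)
  qed
  have "\<mu> * (\<mu> * sum f (P c)) = real k * (\<mu> * sum f (P (\<not> c)))"
    by (simp only: swap[of c] mult.left_commute)
  also have "\<dots> = real k * (real k * sum f (P c))"
    by (simp only: swap[of "\<not> c"] not_not)
  finally have "(\<mu> - real k) * (\<mu> + real k) * sum f (P c) = 0"
    by (simp add: algebra_simps)
  moreover have "\<mu> - real k \<noteq> 0" "\<mu> + real k \<noteq> 0" using \<mu> by linarith+
  ultimately have "sum f (P c) = 0" by (metis mult_eq_0_iff)
  then show ?thesis by (simp only: P_def)
qed

text \<open>Vertices at a distance of the same parity as \<open>d - 1\<close> either lie in the parity ball of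
  radius \<open>d - 1\<close> or are at distance \<open>d + 1\<close>.\<close>

lemma excess_eigen:
  assumes u: "u \<in> V" and \<mu>: "\<mu> \<noteq> real k" "\<mu> \<noteq> - real k"
  shows "(\<Sum>w | w \<in> V \<and> tdist u w = d + 1. f w) = - poly (H_poly k (d - 1)) \<mu> * f u"
proof -
  have "{w \<in> V. even (tdist u w) \<longleftrightarrow> even (d - 1)} = parity_ball (d - 1) u \<union> {w \<in> V. tdist u w = d + 1}"
  proof -
    have "n \<le> d - 1 \<or> n = d + 1" if "n \<le> d + 1" "even n \<longleftrightarrow> even (d - 1)" for n
    proof -
      have "n \<noteq> d" using that d_ge_3 by auto
      then show ?thesis using that by linarith
    qed
    then have "n \<le> d + 1 \<Longrightarrow> (even n \<longleftrightarrow> even (d - 1)) \<longleftrightarrow>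
        n \<le> d - 1 \<and> (even n \<longleftrightarrow> even (d - 1)) \<or> n = d + 1" for n
      using d_ge_3 by auto
    then show ?thesis using tdist_le[OF u] unfolding parity_ball_def by blast
  qed
  moreover have "sum f (parity_ball (d - 1) u \<union> {w \<in> V. tdist u w = d + 1})
      = sum f (parity_ball (d - 1) u) + (\<Sum>w | w \<in> V \<and> tdist u w = d + 1. f w)"
    using finite_V by (intro sum.union_disjoint) (auto simp: parity_ball_def)
  moreover have "sum f (parity_ball (d - 1) u) = poly (H_poly k (d - 1)) \<mu> * f u"
    using H_poly_eigen[of "d - 1" u] u d_ge_3 by simp
  ultimately show ?thesis
    using parity_class_sum_eq_0[OF u \<mu>, of "even (d - 1)"] by simp
qed

end

end

section \<open>Pair graphs\<close>

text \<open>That \<open>u\<close> is a vertex matters for \<open>m = 0\<close>: the empty walk needs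
  one, while \<open>parcs G ^^ 0\<close> is the identity on the whole type.\<close>

lemma (in pair_graph) awalk_relpow:
  assumes "u \<in> pverts G"
  shows "(\<exists>p. awalk u p v \<and> length p = m) \<longleftrightarrow> (u, v) \<in> parcs G ^^ m"
  using assms
proof (induction m arbitrary: u)
  case 0
  then show ?case by (auto simp: awalk_def)
next
  case (Suc m)
  have "(\<exists>p. awalk u p v \<and> length p = Suc m) \<longleftrightarrow>
      (\<exists>w. (u, w) \<in> parcs G \<and> (\<exists>p. awalk w p v \<and> length p = m))"
  proof
    assume "\<exists>p. awalk u p v \<and> length p = Suc m"
    then obtain a p where "awalk u (a # p) v" "length p = m" by (metis length_Suc_conv)
    then show "\<exists>w. (u, w) \<in> parcs G \<and> (\<exists>p. awalk w p v \<and> length p = m)"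
      by (cases a) (auto simp: awalk_Cons_iff)
  next
    assume "\<exists>w. (u, w) \<in> parcs G \<and> (\<exists>p. awalk w p v \<and> length p = m)"
    then obtain w p where "(u, w) \<in> parcs G" "awalk w p v" "length p = m" by blast
    then show "\<exists>p. awalk u p v \<and> length p = Suc m"
      by (intro exI[of _ "(u, w) # p"]) (auto simp: awalk_Cons_iff)
  qed
  also have "\<dots> \<longleftrightarrow> (\<exists>w. (u, w) \<in> parcs G \<and> (w, v) \<in> parcs G ^^ m)"
    using Suc.IH in_arcsD2 by blast
  also have "\<dots> \<longleftrightarrow> (u, v) \<in> parcs G ^^ Suc m"
    unfolding relpow.simps relpow_commute[symmetric] by auto
  finally show ?case .
qed

lemma (in pair_graph) graph_dist_eq_iff:
  assumes "u \<in> pverts G"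
  shows "graph_dist G u v = enat m \<longleftrightarrow>
    (u, v) \<in> parcs G ^^ m \<and> (\<forall>j<m. (u, v) \<notin> parcs G ^^ j)"
proof -
  let ?L = "(\<lambda>p. enat (length p)) ` {p. awalk u p v}"
  have mem: "enat j \<in> ?L \<longleftrightarrow> (u, v) \<in> parcs G ^^ j" for j
    using awalk_relpow[OF assms, of v j] by auto
  have dist: "graph_dist G u v = Inf ?L" by (simp add: graph_dist_def)
  show ?thesis
  proof
    assume eq: "graph_dist G u v = enat m"
    \<comment> \<open>The infimum of the empty set is \<open>\<infinity>\<close>, so a finite
      distance means that walks exist, and the least length is attained.\<close>
    have "?L \<noteq> {}"
    proof
      assume "?L = {}"
      then have "Inf ?L = \<infinity>" by (simp only: Inf_enat_def simp_thms if_True)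
      then show False using eq dist by simp
    qed
    then have "Inf ?L \<in> ?L" unfolding Inf_enat_def by (auto intro: LeastI)
    moreover have "\<not> enat j \<in> ?L" if "j < m" for j
      using Inf_lower[of "enat j" ?L] eq dist that by auto
    ultimately show "(u, v) \<in> parcs G ^^ m \<and> (\<forall>j<m. (u, v) \<notin> parcs G ^^ j)"
      using mem eq dist by metis
  next
    assume R: "(u, v) \<in> parcs G ^^ m \<and> (\<forall>j<m. (u, v) \<notin> parcs G ^^ j)"
    have "Inf ?L = enat m"
    proof (rule antisym)
      show "Inf ?L \<le> enat m" using mem R by (blast intro: Inf_lower)
      have "m \<le> length p" if "awalk u p v" for p
      proof -
        have "(u, v) \<in> parcs G ^^ length p"
          using awalk_relpow[OF assms, of v "length p"] that by blast
        then show ?thesis using R by (blast intro: leI)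
      qed
      then show "enat m \<le> Inf ?L" by (auto intro: Inf_greatest)
    qed
    then show "graph_dist G u v = enat m" using dist by simp
  qed
qed

lemma (in pair_graph) successively_awalk:
  assumes "p \<noteq> []" "hd p \<in> pverts G" "successively (\<lambda>x y. (x, y) \<in> parcs G) p"
  shows "\<exists>q. awalk (hd p) q (last p) \<and> awalk_verts (hd p) q = p"
  using assms
proof (induction p)
  case (Cons x p)
  show ?case
  proof (cases p)
    case Nil
    then show ?thesis using Cons.prems by (intro exI[of _ "[]"]) (auto simp: awalk_Nil_iff)
  next
    case (Cons y p')
    then have "(x, y) \<in> parcs G" using Cons.prems by simp
    moreover obtain q where "awalk y q (last p)" "awalk_verts y q = p"
      using Cons.IH Cons.prems Cons in_arcsD2 by auto
    ultimately show ?thesis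
      using Cons by (intro exI[of _ "(x, y) # q"]) (auto simp: awalk_Cons_iff)
  qed
qed simp

lemma (in pair_graph) girth_le:
  assumes "distinct p" "successively (\<lambda>x y. (x, y) \<in> parcs G) p" "(last p, hd p) \<in> parcs G"
    and "3 \<le> length p"
  shows "girth G \<le> enat (length p)"
proof -
  have ne: "p \<noteq> []" using assms by auto
  obtain q where q: "awalk (hd p) q (last p)" "awalk_verts (hd p) q = p"
    using successively_awalk[OF ne _ assms(2)] assms(3) in_arcsD2 by blast
  \<comment> \<open>Starting at \<open>last p\<close> makes \<open>p\<close> the tail of the vertex
    list, which is the list that \<open>cycle\<close> requires to be distinct.\<close>
  let ?c = "(last p, hd p) # q"
  have len: "length ?c = length p"
    using q(2) length_awalk_verts[of "hd p" q] by simp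
  have "awalk (last p) ?c (last p)" using q assms(3) in_arcsD1 by (auto simp: awalk_Cons_iff)
  then have "cycle ?c"
    using q(2) assms(1) unfolding cycle_def by (intro exI[of _ "last p"]) auto
  then have "girth G \<le> enat (length ?c)"
    unfolding girth_def using len assms(4) by (intro Inf_lower imageI) auto
  then show ?thesis using len by simp
qed

lemma kg_graph_small_excess:
  assumes "kg_graph k (2 * d) G" "3 \<le> d" "excess k (2 * d) G = int e" "e + 2 \<le> k"
  shows "small_excess_graph (pverts G) (parcs G) d k e"
proof -
  interpret pair_graph G using assms(1) by (simp add: kg_graph_def)
  show ?thesis
  proof
    show "finite (pverts G)" by (rule pair_finite_verts)
    show "parcs G \<subseteq> pverts G \<times> pverts G" using in_arcsD1 in_arcsD2 by auto
    show "sym (parcs G)" using arcs_symmetric by (auto intro: symI)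
    show "irrefl (parcs G)" using no_loops' by (auto intro: irreflI)
    show "2 * d \<le> length p" if "distinct p" "successively (\<lambda>x y. (x, y) \<in> parcs G) p"
      "(last p, hd p) \<in> parcs G" "3 \<le> length p" for p
      using girth_le[OF that] assms(1) by (simp add: kg_graph_def)
    show "card (parcs G `` {x}) = k" if "x \<in> pverts G" for x
    proof -
      have "out_arcs (with_proj G) x = Pair x ` (parcs G `` {x})"
        by (auto simp: out_arcs_def)
      then have "out_degree (with_proj G) x = card (parcs G `` {x})"
        by (simp add: out_degree_def card_image inj_on_def)
      then show ?thesis using that assms(1) by (simp add: kg_graph_def)
    qed
    have k: "int k - 1 = int (k - 1)" using assms(4) by simp
    have "int (card (pverts G)) = 2 * (\<Sum>i<d. (int k - 1) ^ i) + int e"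
      using assms(3) by (simp add: excess_def moore_bound_even_def)
    also have "\<dots> = int (2 * (\<Sum>i<d. (k - 1) ^ i) + e)"
      by (simp only: k of_nat_add of_nat_mult of_nat_numeral of_nat_sum of_nat_power)
    finally show "card (pverts G) = 2 * (\<Sum>i<d. (k - 1) ^ i) + e"
      by (simp only: of_nat_eq_iff)
  qed (use assms in auto)
qed

section \<open>From matrices to functions on the vertices\<close>

lemma mult_mat_vec_indicator_nth:
  fixes v :: "real vec"
  assumes "distinct vs" "dim_vec v = length vs" "i < length vs"
    and "\<And>j. j < length vs \<Longrightarrow> v $ j = f (vs ! j)"
  shows "(mat (length vs) (length vs) (\<lambda>(i, j). if R (vs ! i) (vs ! j) then 1 else 0) *\<^sub>v v) $ i
    = (\<Sum>w | w \<in> set vs \<and> R (vs ! i) w. f w)"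
proof -
  have "(mat (length vs) (length vs) (\<lambda>(i, j). if R (vs ! i) (vs ! j) then 1 else 0) *\<^sub>v v) $ i
    = (\<Sum>j<length vs. if R (vs ! i) (vs ! j) then f (vs ! j) else 0)"
    using assms by (auto simp: scalar_prod_def atLeast0LessThan intro!: sum.cong)
  also have "\<dots> = (\<Sum>w\<in>set vs. if R (vs ! i) w then f w else 0)"
    by (rule sum.reindex_bij_betw[OF bij_betw_nth]) (use assms in auto)
  also have "\<dots> = (\<Sum>w | w \<in> set vs \<and> R (vs ! i) w. f w)"
    by (simp add: sum.If_cases Int_def)
  finally show ?thesis .
qed

theorem theorem2p4:
  fixes k g d :: nat
    and G :: "'v pair_pre_digraph"
    and vs :: "'v list"
    and \<mu> :: real
  assumes "k \<ge> 6"
    and "g = 2 * d"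
    and "g \<ge> 6"
    and "kg_graph k g G"
    and "excess k g G = 4"
    and "distinct vs" and "set vs = pverts G"
    and "eigenvalue (adjacency_matrix G vs) \<mu>"
    and "\<mu> \<noteq> real k" and "\<mu> \<noteq> - real k"
  shows "\<exists>\<theta>. eigenvalue (excess_matrix d G vs) \<theta> \<and> poly (H_poly k (d - 1)) \<mu> = - \<theta>"
proof -
  let ?n = "length vs"
  interpret pair_graph G using assms(4) by (simp add: kg_graph_def)
  interpret small_excess_graph "pverts G" "parcs G" d k 4
    by (rule kg_graph_small_excess) (use assms(1-5) in simp_all)
  have dims: "dim_row (adjacency_matrix G vs) = ?n" "dim_row (excess_matrix d G vs) = ?n"
    by (simp_all add: adjacency_matrix_def excess_matrix_def)
  obtain v where "eigenvector (adjacency_matrix G vs) v \<mu>"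
    using assms(8) unfolding eigenvalue_def by blast
  then have v: "dim_vec v = ?n" "v \<noteq> 0\<^sub>v ?n" "adjacency_matrix G vs *\<^sub>v v = \<mu> \<cdot>\<^sub>v v"
    unfolding eigenvector_def dims by auto
  define f where "f w = v $ (THE i. i < ?n \<and> vs ! i = w)" for w
  have f_nth: "v $ j = f (vs ! j)" if "j < ?n" for j
  proof -
    have "(THE i. i < ?n \<and> vs ! i = vs ! j) = j"
      using that assms(6) by (auto simp: nth_eq_iff_index_eq)
    then show ?thesis by (simp add: f_def)
  qed
  have eigen: "(\<Sum>w\<in>parcs G `` {u}. f w) = \<mu> * f u" if "u \<in> pverts G" for u
  proof -
    obtain i where i: "i < ?n" "u = vs ! i" using \<open>u \<in> pverts G\<close> assms(7) by (metis in_set_conv_nth)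
    have "(adjacency_matrix G vs *\<^sub>v v) $ i = (\<Sum>w | w \<in> set vs \<and> (vs ! i, w) \<in> parcs G. f w)"
      unfolding adjacency_matrix_def
      by (rule mult_mat_vec_indicator_nth[where R = "\<lambda>x y. (x, y) \<in> parcs G"])
        (use assms(6) v(1) i f_nth in auto)
    also have "{w. w \<in> set vs \<and> (vs ! i, w) \<in> parcs G} = parcs G `` {u}"
      using i assms(7) E_V by auto
    finally show ?thesis using v i f_nth by simp
  qed
  \<comment> \<open>The same vector \<open>v\<close> is an eigenvector of the excess matrix, with
    the eigenvalue dictated by \<open>excess_eigen\<close>.\<close>
  let ?\<theta> = "- poly (H_poly k (d - 1)) \<mu>"
  have "excess_matrix d G vs *\<^sub>v v = ?\<theta> \<cdot>\<^sub>v v"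
  proof (rule eq_vecI)
    fix i assume "i < dim_vec (?\<theta> \<cdot>\<^sub>v v)"
    then have i: "i < ?n" using v(1) by simp
    then have u: "vs ! i \<in> pverts G" using assms(7) by (metis nth_mem)
    \<comment> \<open>The value \<open>d + 1\<close> lies just below the cap \<open>d + 2\<close>,
      so truncated and true distance agree on it.\<close>
    have iff: "graph_dist G (vs ! i) w = enat (d + 1) \<longleftrightarrow> tdist (vs ! i) w = d + 1" for w
    proof -
      have "tdist (vs ! i) w = d + 1 \<longleftrightarrow> (vs ! i, w) \<in> parcs G ^^ (d + 1)
          \<and> (\<forall>j<d + 1. (vs ! i, w) \<notin> parcs G ^^ j)"
        using tdist_walk[of "vs ! i" w] tdist_le_walk[of "vs ! i" w]
        by (metis Suc_eq_plus1 add_2_eq_Suc' le_neq_implies_less lessI less_SucI linorder_not_le)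
      then show ?thesis using graph_dist_eq_iff[OF u] by blast
    qed
    have "(excess_matrix d G vs *\<^sub>v v) $ i
        = (\<Sum>w | w \<in> set vs \<and> graph_dist G (vs ! i) w = enat (d + 1). f w)"
      unfolding excess_matrix_def
      by (rule mult_mat_vec_indicator_nth[where R = "\<lambda>x y. graph_dist G x y = enat (d + 1)"])
        (use assms(6) v(1) i f_nth in auto)
    also have "\<dots> = (\<Sum>w | w \<in> pverts G \<and> tdist (vs ! i) w = d + 1. f w)"
      by (simp only: iff assms(7))
    also have "\<dots> = ?\<theta> * f (vs ! i)"
      using excess_eigen[OF eigen u assms(9,10)] .
    finally show "(excess_matrix d G vs *\<^sub>v v) $ i = (?\<theta> \<cdot>\<^sub>v v) $ i"
      using i v(1) f_nth by simp
  qed (simp add: excess_matrix_def v(1))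
  then have "eigenvalue (excess_matrix d G vs) ?\<theta>"
    unfolding eigenvalue_def eigenvector_def dims using v(1,2) by (blast intro: carrier_vecI)
  then show ?thesis by (intro exI[of _ ?\<theta>]) simp
qed

end
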